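(* Let $a\in\mathbb{R}$, $\mu\in\mathbb{R}\setminus\mathbb{N}^{-1}$ and $\nu\in\mathbb{R}\setminus\mathbb{N}^0$. Then $$\Delta_{a+\mu}^{-\nu}[(s-a)^{\underline{\mu}}](t)=\frac{\Gamma(\mu+1)}{(t-a-\mu-\nu)!}\,(\mu+\nu+1)_{t-a-\mu-\nu}\quad\text{for all } t\in\mathbb{N}_{a+\mu+\nu},$$ where the left-hand side is the fractional sum-difference operator of order $\nu$ based at $a+\mu$, applied to the function $s\mapsto (s-a)^{\underline{\mu}}$ on $\mathbb{N}_{a+\mu}$ and evaluated at $t$.
   Context: For a real number $c$, $\mathbb{N}_c=\{c,c+1,c+2,\ldots\}$ and $\mathbb{N}^c=\{\ldots,c-2,c-1,c\}$; in particular $\mathbb{N}^{0}$ is the set of non-positive integers and $\mathbb{N}^{-1}$ the set of negative integers. Falling function: for $x,y\in\mathbb{R}$, $(x)^{\underline{y}}=x^{\underline{y}}$ equals $x(x-1)\cdots(x-y+1)$ if $y\in\mathbb{N}_1$; $1$ if $y=0$; $\frac{\Gamma(x+1)}{\Gamma(x+1-y)}$ if $x,\,x-y\notin\mathbb{N}^{-1}$; and $0$ if $x\notin\mathbb{N}^{-1}$ and $x-y\in\mathbb{N}^{-1}$. Pochhammer symbol: for $x\in\mathbb{R}$ and an integer $k\ge0$, $(x)_k=x(x+1)\cdots(x+k-1)$ for $k\ge1$ and $(x)_0=1$. Fractional sum-difference operator (Miller--Ross): for $c\in\mathbb{R}$, $\nu\in\mathbb{R}\setminus\mathbb{N}^0$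 and $f:\mathbb{N}_c\to\mathbb{R}$, $$\Delta_c^{-\nu}f(t)=\frac{1}{\Gamma(\nu)}\sum_{s=c}^{t-\nu}(t-(s+1))^{\underline{\nu-1}}f(s),\quad t\in\mathbb{N}_{c+\nu},$$ where $s$ runs over $c,c+1,\ldots,t-\nu$. *)

theory Defs
  imports "HOL-Analysis.Analysis"
begin

definition nats_from :: "real \<Rightarrow> real set" where
  "nats_from c = {c + real n | n. True}"

definition nats_upto :: "real \<Rightarrow> real set" where
  "nats_upto c = {c - real n | n. True}"

(* The falling function is a partial function: it has no value when x is a negative
   integer and y is not a non-negative integer.  The last branch covers that case.
   When y is a positive integer, the floor in the first branch is exact. *)
definition falling :: "real \<Rightarrow> real \<Rightarrow> real" where
  "falling x y =
    (if y \<in> nats_from 1 then (\<Prod>i<nat \<lfloor>y\<rfloor>. x - real i)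
     else if y = 0 then 1
     else if x \<notin> nats_upto (-1) \<and> x - y \<notin> nats_upto (-1)
       then Gamma (x + 1) / Gamma (x + 1 - y)
     else if x \<notin> nats_upto (-1) \<and> x - y \<in> nats_upto (-1) then 0
     else undefined)"

(* fracsum c \<nu> f t is the Miller-Ross operator of order -\<nu> based at c.  It is meant for
   \<nu> not a non-positive integer and t in nats_from (c + \<nu>); only the values of f on
   nats_from c enter, and s then runs over c, c + 1, ..., t - \<nu>. *)
definition fracsum :: "real \<Rightarrow> real \<Rightarrow> (real \<Rightarrow> real) \<Rightarrow> real \<Rightarrow> real" where
  "fracsum c \<nu> f t =
    1 / Gamma \<nu> * (\<Sum>s | s \<in> nats_from c \<and> s \<le> t - \<nu>. falling (t - (s + 1)) (\<nu> - 1) * f s)"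

end

theory Submission
  imports Defs
begin

text \<open>
  The summation runs over \<open>s = a + \<mu> + k\<close> with \<open>0 \<le> k \<le> n\<close>, where \<open>t = a + \<mu> + \<nu> + n\<close>. There
  both falling powers have the form \<open>falling (x + m) x\<close> with \<open>m\<close> a natural number: the kernel
  with \<open>x = \<nu> - 1\<close> and \<open>m = n - k\<close>, the summed function with \<open>x = \<mu>\<close> and \<open>m = k\<close>. Such a
  power is \<open>\<Gamma>(x + 1) (x + 1)\<^sub>m / m!\<close> (lemma \<open>falling_add_nat_self\<close>), so every Gamma
  value leaves the sum: \<open>\<Gamma>(\<nu>)\<close> cancels, and \<open>\<Gamma>(\<mu> + 1)\<close> is a constant factor. What
  remains is the convolution of \<open>(\<nu>)\<^sub>m / m!\<close> with \<open>(\<mu> + 1)\<^sub>k / k!\<close>, which the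
  Chu--Vandermonde identity evaluates to \<open>(\<mu> + \<nu> + 1)\<^sub>n / n!\<close>.
\<close>

lemma nats_upto_minus_one_iff: "x \<in> nats_upto (-1) \<longleftrightarrow> x + 1 \<in> \<int>\<^sub>\<le>\<^sub>0"
proof
  assume "x \<in> nats_upto (-1)"
  then obtain n where "x = -1 - real n"
    by (auto simp: nats_upto_def)
  then have "x + 1 = - real n"
    by simp
  then show "x + 1 \<in> \<int>\<^sub>\<le>\<^sub>0"
    by simp
next
  assume "x + 1 \<in> \<int>\<^sub>\<le>\<^sub>0"
  then obtain n where "x + 1 = - real n"
    by (auto elim: nonpos_Ints_cases')
  then have "x = -1 - real n"
    by simp
  then show "x \<in> nats_upto (-1)"
    by (auto simp: nats_upto_def)
qed

lemma nats_upto_zero_iff: "x \<in> nats_upto 0 \<longleftrightarrow> x \<in> \<int>\<^sub>\<le>\<^sub>0"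
  by (auto simp: nats_upto_def elim!: nonpos_Ints_cases')

lemma prod_descending_eq_fact_div:
  "(\<Prod>i<N. real N + real m - real i) = fact (N + m) / fact m"
proof (induction N)
  case (Suc N)
  have "(\<Prod>i<Suc N. real (Suc N) + real m - real i)
      = (real (Suc N) + real m) * (\<Prod>i<N. real N + real m - real i)"
    by (subst prod.lessThan_Suc_shift) (simp add: algebra_simps)
  then show ?case
    by (simp add: Suc.IH algebra_simps)
qed simp

text \<open>
  All branches of the falling power that can occur here agree with \<open>\<Gamma>(x + m + 1) / m!\<close>.
  If \<open>x\<close> is a natural number, both sides are quotients of factorials. Otherwise the Gamma
  branch applies: \<open>(x + m) - x = m\<close> is never a negative integer, and if \<open>x + m\<close> were one, so
  would be \<open>x\<close>. The functional equation of \<open>\<Gamma>\<close> then splits off the Pochhammer symbol.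
\<close>

lemma falling_add_nat_self:
  assumes x: "x \<notin> nats_upto (-1)"
  shows "falling (x + real m) x = Gamma (x + 1) * pochhammer (x + 1) m / fact m"
proof -
  have np: "x + 1 \<notin> \<int>\<^sub>\<le>\<^sub>0"
    using x by (simp add: nats_upto_minus_one_iff)
  have "falling (x + real m) x = Gamma (x + real m + 1) / fact m"
  proof (cases "x \<in> nats_from 1")
    case True
    then obtain j where "x = 1 + real j"
      by (auto simp: nats_from_def)
    then have N: "x = real (Suc j)"
      by simp
    then have "falling (x + real m) x = (\<Prod>i<Suc j. real (Suc j) + real m - real i)"
      using True by (simp add: falling_def del: prod.lessThan_Suc of_nat_Suc)
    also have "\<dots> = fact (Suc j + m) / fact m"
      by (rule prod_descending_eq_fact_div)
    also have "fact (Suc j + m) = Gamma (x + real m + 1)"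
      using Gamma_fact[of "Suc j + m", where 'a = real] N by (simp add: algebra_simps)
    finally show ?thesis .
  next
    case False
    have m: "real m + 1 \<notin> \<int>\<^sub>\<le>\<^sub>0"
      by (auto elim!: nonpos_Ints_cases')
    have xm: "x + real m + 1 \<notin> \<int>\<^sub>\<le>\<^sub>0"
    proof
      assume "x + real m + 1 \<in> \<int>\<^sub>\<le>\<^sub>0"
      then obtain j where "x + real m + 1 = - real j"
        by (auto elim: nonpos_Ints_cases')
      then have "x + 1 = - real (j + m)"
        by simp
      then show False
        using np by (simp del: of_nat_add)
    qed
    have "Gamma (real m + 1) = fact m"
      using Gamma_fact[of m, where 'a = real] by (simp add: add.commute)
    then show ?thesis
      using False m xm
      by (cases "x = 0") (simp_all add: falling_def nats_upto_minus_one_iff)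
  qed
  moreover have "Gamma (x + real m + 1) = Gamma (x + 1) * pochhammer (x + 1) m"
    using pochhammer_Gamma[OF np, of m] np by (simp add: Gamma_eq_zero_iff algebra_simps)
  ultimately show ?thesis
    by simp
qed

text \<open>
  The number \<open>(a)\<^sub>k / k!\<close> is the coefficient of \<open>z\<^sup>k\<close> in the binomial series of
  \<open>(1 - z)\<close> to the power \<open>- a\<close>, so this form of Chu--Vandermonde compares coefficients in the
  product of two such series. It is the known binomial sum with the factorials distributed.
\<close>

lemma pochhammer_div_fact_convolution:
  fixes a b :: real
  shows "(\<Sum>k\<le>n. pochhammer a k / fact k * (pochhammer b (n - k) / fact (n - k)))
    = pochhammer (a + b) n / fact n"
  unfolding pochhammer_binomial_sum sum_divide_distrib
  by (intro sum.cong refl) (simp add: binomial_fact)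

text \<open>
  Substituting \<open>s = c + k\<close> turns the sum over real points into one over \<open>0, \<dots>, n\<close> and puts
  the kernel \<open>t - (s + 1)\<close> into the form \<open>(\<nu> - 1) + (n - k)\<close>, a natural number above the
  order \<open>\<nu> - 1\<close> of the falling power.
\<close>

lemma fracsum_at_nat:
  "fracsum c \<nu> f (c + \<nu> + real n)
    = 1 / Gamma \<nu> * (\<Sum>k\<le>n. falling (\<nu> - 1 + real (n - k)) (\<nu> - 1) * f (c + real k))"
proof -
  have "{s. s \<in> nats_from c \<and> s \<le> c + \<nu> + real n - \<nu>} = (\<lambda>k. c + real k) ` {..n}"
    by (auto simp: nats_from_def)
  then show ?thesis
    by (simp add: fracsum_def sum.reindex inj_on_def of_nat_diff algebra_simps)
qed

theorem theorem3p3: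
  fixes a \<mu> \<nu> :: real
  assumes "\<mu> \<notin> nats_upto (-1)"
    and "\<nu> \<notin> nats_upto 0"
  shows "\<forall>t \<in> nats_from (a + \<mu> + \<nu>).
    fracsum (a + \<mu>) \<nu> (\<lambda>s. falling (s - a) \<mu>) t =
      Gamma (\<mu> + 1) / fact (nat \<lfloor>t - a - \<mu> - \<nu>\<rfloor>)
        * pochhammer (\<mu> + \<nu> + 1) (nat \<lfloor>t - a - \<mu> - \<nu>\<rfloor>)"
proof
  fix t
  assume "t \<in> nats_from (a + \<mu> + \<nu>)"
  then obtain n where t: "t = a + \<mu> + \<nu> + real n"
    by (auto simp: nats_from_def)
  then have "t - a - \<mu> - \<nu> = real n"
    by simp
  then have n: "nat \<lfloor>t - a - \<mu> - \<nu>\<rfloor> = n"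
    by simp
  have \<nu>: "\<nu> \<notin> \<int>\<^sub>\<le>\<^sub>0"
    using assms(2) by (simp add: nats_upto_zero_iff)
  then have \<nu>1: "\<nu> - 1 \<notin> nats_upto (-1)"
    by (simp add: nats_upto_minus_one_iff)
  have kernel: "falling (\<nu> - 1 + real m) (\<nu> - 1) = Gamma \<nu> * pochhammer \<nu> m / fact m" for m
    using falling_add_nat_self[OF \<nu>1] by simp
  have "fracsum (a + \<mu>) \<nu> (\<lambda>s. falling (s - a) \<mu>) t
      = 1 / Gamma \<nu> * (\<Sum>k\<le>n. falling (\<nu> - 1 + real (n - k)) (\<nu> - 1) * falling (\<mu> + real k) \<mu>)"
    using fracsum_at_nat[of "a + \<mu>" \<nu> "\<lambda>s. falling (s - a) \<mu>" n] by (simp add: t algebra_simps)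
  also have "\<dots> = Gamma (\<mu> + 1)
      * (\<Sum>k\<le>n. pochhammer (\<mu> + 1) k / fact k * (pochhammer \<nu> (n - k) / fact (n - k)))"
    using \<nu> unfolding kernel falling_add_nat_self[OF assms(1)] sum_distrib_left
    by (intro sum.cong refl) (simp add: Gamma_eq_zero_iff field_simps)
  also have "\<dots> = Gamma (\<mu> + 1) / fact n * pochhammer (\<mu> + \<nu> + 1) n"
    unfolding pochhammer_div_fact_convolution by (simp add: add_ac)
  finally show "fracsum (a + \<mu>) \<nu> (\<lambda>s. falling (s - a) \<mu>) t =
      Gamma (\<mu> + 1) / fact (nat \<lfloor>t - a - \<mu> - \<nu>\<rfloor>)
        * pochhammer (\<mu> + \<nu> + 1) (nat \<lfloor>t - a - \<mu> - \<nu>\<rfloor>)"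
    unfolding n .
qed

end
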